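(* Let $d\ge1$, let $\{P_n\}_{n\ge0}$ be a monic $d$-OPS with $P_n(0)\ne0$ for all $n\ge1$, let $J_d$ be its monic lower Hessenberg matrix, with factorization $J_d=LU$, and let $\{K_n\}_{n\ge0}$ be the monic polynomial sequence generated by the matrix $UL$. Then $$P_n=K_n+l_{n,n}K_{n-1}+l_{n,n-1}K_{n-2}+\dots+l_{n,n-d+1}K_{n-d},\quad n\ge0,$$ and $$xK_n(x)=P_{n+1}(x)-\frac{P_{n+1}(0)}{P_n(0)}P_n(x),\quad n\ge0.$$
   Context: A monic $d$-OPS is given by complex numbers $\beta_n$ ($n\ge0$) and $\gamma_n^s$ ($n\ge1$, $0\le s\le d-1$) with $\gamma_n^0\ne0$ for all $n\ge1$, by $P_n=0$ for $n<0$, $P_0=1$, $P_{n+1}(x)=(x-\beta_n)P_n(x)-\sum_{\nu=0}^{d-1}\gamma_{n-\nu}^{d-1-\nu}P_{n-1-\nu}(x)$, $n\ge0$ (terms with $n-1-\nu<0$ are zero). Its monic lower Hessenberg matrix is the infinite matrix $J_d=(a_{i,j})_{i,j\ge0}$ with $a_{i,i+1}=1$, $a_{i,i}=\beta_i$, $a_{i+r,i}=\gamma_{i+1}^{d-r}$ for $1\le r\le d$, and all other entries $0$, so that $x(P_0,P_1,\dots)^T=J_d(P_0,P_1,\dots)^T$. In the factorization $J_d=LU$ (rows and columns of $L,U$ numbered from $1$): $U$ is upper bidiagonal with diagonal entries $m_1,m_2,\dots$ and $1$'s on the superdiagonal; $L$ is unit lower triangular with $d$ subdiagonals, its entry in row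 $j+1$, column $i$ being $l_{j,i}$ for $i\le j\le i+d-1$ (so the first column is $1,l_{11},\dots,l_{d1},0,0,\dots$). The sequence generated by $UL$ is the monic sequence with $x(K_0,K_1,\dots)^T=UL\,(K_0,K_1,\dots)^T$, $K_0=1$; terms with $K$ of negative index are zero. *)

theory Defs
  imports
    Complex_Main
    "HOL-Computational_Algebra.Polynomial"
    "HOL-Library.Groups_Big_Fun"
begin

(* Sequences are indexed by nat; the convention that polynomials of negative index vanish
   appears as an explicit guard under the sums. The superscript in gamma_n^s is the second
   argument: gamma n s. *)
definition monic_d_OPS ::
    "nat \<Rightarrow> (nat \<Rightarrow> complex) \<Rightarrow> (nat \<Rightarrow> nat \<Rightarrow> complex) \<Rightarrow> (nat \<Rightarrow> complex poly) \<Rightarrow> bool" where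
  "monic_d_OPS d \<beta> \<gamma> P \<longleftrightarrow>
     (\<forall>n\<ge>1. \<gamma> n 0 \<noteq> 0) \<and>
     P 0 = 1 \<and>
     (\<forall>n. P (n + 1) = [:- \<beta> n, 1:] * P n
            - (\<Sum>\<nu><d. if \<nu> < n then smult (\<gamma> (n - \<nu>) (d - 1 - \<nu>)) (P (n - 1 - \<nu>)) else 0))"

(* Infinite matrices are functions of a row and a column, both numbered from 0. *)
type_synonym inf_matrix = "nat \<Rightarrow> nat \<Rightarrow> complex"

(* Sum_any is the sum over the support of its argument, which is finite for the banded
   matrices used here. *)
definition inf_matrix_mult :: "inf_matrix \<Rightarrow> inf_matrix \<Rightarrow> inf_matrix" where
  "inf_matrix_mult A B = (\<lambda>i j. Sum_any (\<lambda>k. A i k * B k j))"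

definition hessenberg_matrix ::
    "nat \<Rightarrow> (nat \<Rightarrow> complex) \<Rightarrow> (nat \<Rightarrow> nat \<Rightarrow> complex) \<Rightarrow> inf_matrix" where
  "hessenberg_matrix d \<beta> \<gamma> = (\<lambda>i j.
     if j = i + 1 then 1
     else if j = i then \<beta> i
     else if j < i \<and> i \<le> j + d then \<gamma> (j + 1) (d - (i - j))
     else 0)"

(* The families l and m keep the numbering from 1 of rows and columns: the 0-based position
   (i, j) is row i + 1, column j + 1, and the entry of L in row i + 1, column j + 1 is
   l i (j + 1) for j + 1 \<le> i \<le> (j + 1) + d - 1. Values of l and m outside these ranges
   are irrelevant. *)
definition L_matrix :: "nat \<Rightarrow> (nat \<Rightarrow> nat \<Rightarrow> complex) \<Rightarrow> inf_matrix" where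
  "L_matrix d l = (\<lambda>i j.
     if i = j then 1
     else if j + 1 \<le> i \<and> i \<le> j + d then l i (j + 1)
     else 0)"

definition U_matrix :: "(nat \<Rightarrow> complex) \<Rightarrow> inf_matrix" where
  "U_matrix m = (\<lambda>i j. if j = i then m (i + 1) else if j = i + 1 then 1 else 0)"

definition monic_sequence_generated_by :: "inf_matrix \<Rightarrow> (nat \<Rightarrow> complex poly) \<Rightarrow> bool" where
  "monic_sequence_generated_by M Q \<longleftrightarrow>
     Q 0 = 1 \<and>
     (\<forall>n. degree (Q n) = n \<and> lead_coeff (Q n) = 1) \<and>
     (\<forall>n. [:0, 1:] * Q n = Sum_any (\<lambda>k. smult (M n k) (Q k)))"

lemma Sum_any_atMost:
  fixes f :: "nat \<Rightarrow> 'a::comm_monoid_add"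
  assumes "\<And>k. k > n \<Longrightarrow> f k = 0"
  shows "Sum_any f = sum f {..n}"
  by (rule Sum_any.expand_superset) (use assms in \<open>auto simp: not_less[symmetric]\<close>)

lemma monic_sequence_generated_byI:
  assumes sup: "\<And>i. M i (i + 1) = 1" and up: "\<And>i j. j > i + 1 \<Longrightarrow> M i j = 0"
    and Q0: "Q 0 = 1"
    and rec: "\<And>n. Q (n + 1) = [:0, 1:] * Q n - (\<Sum>k\<le>n. smult (M n k) (Q k))"
  shows "monic_sequence_generated_by M Q"
proof -
  have monic: "degree (Q n) = n \<and> lead_coeff (Q n) = 1" for n
  proof (induction n rule: less_induct)
    case (less n)
    show ?case
    proof (cases n)
      case 0
      then show ?thesis by (simp add: Q0)
    next
      case (Suc k)
      have IH: "degree (Q k) = k" "coeff (Q k) k = 1" using less.IH[of k] unfolding Suc by (metis lessI)+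
      let ?S = "\<Sum>j\<le>k. smult (M k j) (Q j)"
      have nz: "Q k \<noteq> 0" using IH(2) by auto
      have dS: "degree ?S \<le> k"
        by (rule degree_sum_le)
           (use less Suc in \<open>auto intro!: order.trans[OF degree_smult_le]\<close>)
      have eq: "Q n = pCons 0 (Q k) - ?S" using rec[of k] Suc by simp
      have "coeff ?S n = 0" by (rule coeff_eq_0) (use dS Suc in simp)
      then have c: "coeff (Q n) n = 1" unfolding eq using IH(2) Suc by simp
      have "degree (Q n) \<le> n"
        unfolding eq using IH(1) dS Suc nz by (intro degree_diff_le) auto
      moreover have "n \<le> degree (Q n)" using c by (intro le_degree) simp
      ultimately show ?thesis using c by auto
    qed
  qed
  have "[:0, 1:] * Q n = Sum_any (\<lambda>k. smult (M n k) (Q k))" for n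
  proof -
    have "Sum_any (\<lambda>k. smult (M n k) (Q k)) = (\<Sum>k\<le>n + 1. smult (M n k) (Q k))"
      by (rule Sum_any_atMost) (use up in auto)
    also have "\<dots> = [:0, 1:] * Q n" using rec[of n] sup[of n] by simp
    finally show ?thesis by simp
  qed
  with monic Q0 show ?thesis unfolding monic_sequence_generated_by_def by blast
qed

lemma monic_d_OPS_generated_by_hessenberg:
  assumes "monic_d_OPS d \<beta> \<gamma> P"
  shows "monic_sequence_generated_by (hessenberg_matrix d \<beta> \<gamma>) P"
proof (rule monic_sequence_generated_byI)
  fix n
  let ?M = "hessenberg_matrix d \<beta> \<gamma>"
  let ?t = "\<lambda>\<nu>. smult (\<gamma> (n - \<nu>) (d - 1 - \<nu>)) (P (n - 1 - \<nu>))"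
  have "(\<Sum>k\<le>n. smult (?M n k) (P k)) = smult (\<beta> n) (P n) + (\<Sum>k<n. smult (?M n k) (P k))"
    by (simp add: lessThan_Suc_atMost[symmetric] hessenberg_matrix_def add.commute)
  also have "(\<Sum>k<n. smult (?M n k) (P k)) = (\<Sum>\<nu><n. smult (?M n (n - Suc \<nu>)) (P (n - Suc \<nu>)))"
    by (rule sum.nat_diff_reindex[symmetric])
  also have "\<dots> = (\<Sum>\<nu><n. if \<nu> < d then ?t \<nu> else 0)"
    by (rule sum.cong) (auto simp: hessenberg_matrix_def Suc_diff_Suc)
  also have "\<dots> = (\<Sum>\<nu>\<in>{..<n} \<inter> {\<nu>. \<nu> < d}. ?t \<nu>)"
    by (simp add: sum.If_cases)
  also have "{..<n} \<inter> {\<nu>. \<nu> < d} = {..<d} \<inter> {\<nu>. \<nu> < n}" by auto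
  also have "(\<Sum>\<nu>\<in>\<dots>. ?t \<nu>) = (\<Sum>\<nu><d. if \<nu> < n then ?t \<nu> else 0)"
    by (simp add: sum.If_cases)
  finally show "P (n + 1) = [:0, 1:] * P n - (\<Sum>k\<le>n. smult (?M n k) (P k))"
    using assms by (simp add: monic_d_OPS_def)
qed (use assms in \<open>auto simp: hessenberg_matrix_def monic_d_OPS_def\<close>)

lemma inf_matrix_mult_L_U:
  "inf_matrix_mult (L_matrix d l) (U_matrix m) i j =
     L_matrix d l i j * m (j + 1) + (if j = 0 then 0 else L_matrix d l i (j - 1))"
proof -
  have "inf_matrix_mult (L_matrix d l) (U_matrix m) i j
      = (\<Sum>k\<le>j. L_matrix d l i k * U_matrix m k j)"
    unfolding inf_matrix_mult_def
    by (rule Sum_any_atMost) (auto simp: U_matrix_def)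
  also have "\<dots> = (\<Sum>k\<in>{j} \<union> (if j = 0 then {} else {j - 1}). L_matrix d l i k * U_matrix m k j)"
    by (rule sum.mono_neutral_right) (auto simp: U_matrix_def)
  also have "\<dots> = L_matrix d l i j * m (j + 1) + (if j = 0 then 0 else L_matrix d l i (j - 1))"
    by (auto simp: U_matrix_def)
  finally show ?thesis .
qed

(* The factorization exists whenever no P n with n \<ge> 1 vanishes at 0. *)
lemma hessenberg_matrix_LU_exists:
  assumes P: "monic_d_OPS d \<beta> \<gamma> P" and nz: "\<And>n. n \<ge> 1 \<Longrightarrow> poly (P n) 0 \<noteq> 0"
  shows "\<exists>l m. hessenberg_matrix d \<beta> \<gamma> = inf_matrix_mult (L_matrix d l) (U_matrix m)"
proof -
  let ?J = "hessenberg_matrix d \<beta> \<gamma>"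
  define p where "p n = poly (P n) 0" for n
  have pnz: "p n \<noteq> 0" for n
    using nz[of n] P by (cases n) (auto simp: p_def monic_d_OPS_def)
  define m where "m n = - p n / p (n - 1)" for n
  have mnz: "m (Suc n) \<noteq> 0" for n using pnz by (simp add: m_def)
  define l where "l i j = rec_nat 0 (\<lambda>k x. (?J i k - x) / m (Suc k)) j" for i j
  have l0: "l i 0 = 0" and lS: "l i (Suc k) = (?J i k - l i k) / m (Suc k)" for i k
    by (simp_all add: l_def)
  have band: "l i j = 0" if "j + d \<le> i" for i j
    using that by (induction j) (auto simp: l0 lS hessenberg_matrix_def)
  let ?L = "L_matrix d l"
  let ?LU = "inf_matrix_mult ?L (U_matrix m)"
  have Ll: "?L i j = l i (Suc j)" if "j < i" for i j
    using that band[of "Suc j" i] by (auto simp: L_matrix_def)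
  have below: "?LU i j = ?J i j" if "j < i" for i j
    unfolding inf_matrix_mult_L_U
    using that mnz[of j] by (cases j) (auto simp: Ll lS l0)
  have above: "?LU i j = ?J i j" if "i < j" for i j
    unfolding inf_matrix_mult_L_U
    using that by (auto simp: L_matrix_def hessenberg_matrix_def)
  have Jp: "(\<Sum>j\<le>i + 1. ?J i j * p j) = 0" for i
  proof -
    have "Sum_any (\<lambda>k. smult (?J i k) (P k)) = (\<Sum>k\<le>i + 1. smult (?J i k) (P k))"
      by (rule Sum_any_atMost) (auto simp: hessenberg_matrix_def)
    then have "[:0, 1:] * P i = (\<Sum>k\<le>i + 1. smult (?J i k) (P k))"
      using monic_d_OPS_generated_by_hessenberg[OF P]
      by (simp add: monic_sequence_generated_by_def)
    then have "poly ([:0, 1:] * P i) 0 = poly (\<Sum>k\<le>i + 1. smult (?J i k) (P k)) 0" by simp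
    then show ?thesis by (simp add: poly_sum p_def)
  qed
  have tele: "(\<Sum>j\<le>n. ?LU i j * p j) = - ?L i n * p (n + 1)" for i n
  proof (induction n)
    case 0
    show ?case using pnz by (simp add: inf_matrix_mult_L_U m_def)
  next
    case (Suc n)
    then show ?case using pnz[of "Suc n"]
      by (simp add: inf_matrix_mult_L_U m_def algebra_simps)
  qed
  have diag: "?LU i i = ?J i i" for i
  proof -
    have "(\<Sum>j\<le>i + 1. ?LU i j * p j) = 0"
      by (subst tele) (simp add: L_matrix_def)
    then have "(\<Sum>j<i. ?LU i j * p j) + ?LU i i * p i + ?LU i (Suc i) * p (Suc i)
        = (\<Sum>j<i. ?J i j * p j) + ?J i i * p i + ?J i (Suc i) * p (Suc i)"
      using Jp[of i] by (simp add: lessThan_Suc_atMost[symmetric])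
    then show ?thesis using pnz[of i] by (simp add: below above)
  qed
  have "?J i j = ?LU i j" for i j
    using below[of j i] above[of i j] diag[of i] by (cases i j rule: linorder_cases) auto
  then show ?thesis by blast
qed

end

(* Put Q = L K. Then x K = U L K = U Q, so x Q = L (x K) = L U Q = J_d Q with Q_0 = 1. A unit lower
   Hessenberg matrix determines such a sequence, hence Q = P, which is the first identity. The
   second one is x K = U P, where the diagonal of U is found by evaluation at 0. *)
theory Submission
  imports Defs
begin

text \<open>Because the superdiagonal entry is 1, row \<open>n\<close> can be solved for the
  polynomial of index \<open>Suc n\<close> in terms of those of index at most \<open>n\<close>;
  strong induction then propagates equality from index 0.\<close>

lemma hessenberg_recurrence_unique:
  fixes P Q :: "nat \<Rightarrow> 'a::comm_ring_1 poly"
  assumes sup: "\<And>n. M n (Suc n) = 1"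
    and P: "\<And>n. [:0, 1:] * P n = (\<Sum>k\<le>Suc n. smult (M n k) (P k))"
    and Q: "\<And>n. [:0, 1:] * Q n = (\<Sum>k\<le>Suc n. smult (M n k) (Q k))"
    and init: "P 0 = Q 0"
  shows "P n = Q n"
proof (induction n rule: less_induct)
  case (less n)
  show ?case
  proof (cases n)
    case (Suc k)
    have "P (Suc k) = [:0, 1:] * P k - (\<Sum>j\<le>k. smult (M k j) (P j))"
      unfolding P by (simp add: sup)
    also have "\<dots> = [:0, 1:] * Q k - (\<Sum>j\<le>k. smult (M k j) (Q j))"
      using less Suc by simp
    also have "\<dots> = Q (Suc k)"
      unfolding Q by (simp add: sup)
    finally show ?thesis by (simp only: Suc)
  qed (simp add: init)
qed

lemma inf_matrix_mult_U_L:
  "inf_matrix_mult (U_matrix m) (L_matrix d l) i j =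
     m (i + 1) * L_matrix d l i j + L_matrix d l (i + 1) j"
proof -
  have "inf_matrix_mult (U_matrix m) (L_matrix d l) i j
      = (\<Sum>k\<in>{i, i + 1}. U_matrix m i k * L_matrix d l k j)"
    unfolding inf_matrix_mult_def
    by (rule Sum_any.expand_superset) (auto simp: U_matrix_def split: if_splits)
  also have "\<dots> = m (i + 1) * L_matrix d l i j + L_matrix d l (i + 1) j"
    by (simp add: U_matrix_def)
  finally show ?thesis .
qed

lemma L_matrix_above: "i < j \<Longrightarrow> L_matrix d l i j = 0"
  by (simp add: L_matrix_def)

text \<open>Brings \<open>L K\<close> into the form of the first identity: the row is read leftwards
  from its unit diagonal, with \<open>k\<close> the distance to the diagonal. The guard
  \<open>k \<le> n\<close> cuts the band off at the first column.\<close>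

lemma L_matrix_row_sum:
  "(\<Sum>k\<le>n. smult (L_matrix d l n k) (K k)) =
     K n + (\<Sum>k=1..d. if k \<le> n then smult (l n (n + 1 - k)) (K (n - k)) else 0)"
proof -
  let ?t = "\<lambda>k. smult (L_matrix d l n k) (K k)"
  have "(\<Sum>k\<le>n. ?t k) = ?t n + (\<Sum>k<n. ?t k)"
    by (simp add: lessThan_Suc_atMost[symmetric] add.commute)
  also have "(\<Sum>k<n. ?t k) = (\<Sum>k\<in>{k. k < n \<and> n \<le> k + d}. ?t k)"
    by (rule sum.mono_neutral_right) (auto simp: L_matrix_def)
  \<comment> \<open>The 0-based column \<open>n - k\<close> is column \<open>n + 1 - k\<close> in
    the numbering of \<open>l\<close>.\<close>
  also have "\<dots> = (\<Sum>k\<in>{k\<in>{1..d}. k \<le> n}. smult (l n (n + 1 - k)) (K (n - k)))"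
    by (rule sum.reindex_bij_witness[where i = "\<lambda>k. n - k" and j = "\<lambda>k. n - k"])
       (auto simp: L_matrix_def Suc_diff_le)
  also have "\<dots> = (\<Sum>k=1..d. if k \<le> n then smult (l n (n + 1 - k)) (K (n - k)) else 0)"
    by (rule sum.inter_filter) simp
  finally show ?thesis by (simp add: L_matrix_def)
qed

theorem proposition7p1:
  fixes d :: nat
    and \<beta> :: "nat \<Rightarrow> complex"
    and \<gamma> :: "nat \<Rightarrow> nat \<Rightarrow> complex"
    and P K :: "nat \<Rightarrow> complex poly"
    and l :: "nat \<Rightarrow> nat \<Rightarrow> complex"
    and m :: "nat \<Rightarrow> complex"
  assumes "d \<ge> 1"
    and "monic_d_OPS d \<beta> \<gamma> P"
    and "\<forall>n\<ge>1. poly (P n) 0 \<noteq> 0"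
    and "hessenberg_matrix d \<beta> \<gamma> = inf_matrix_mult (L_matrix d l) (U_matrix m)"
    and "monic_sequence_generated_by (inf_matrix_mult (U_matrix m) (L_matrix d l)) K"
  shows "(\<forall>n. P n = K n + (\<Sum>k=1..d. if k \<le> n then smult (l n (n + 1 - k)) (K (n - k)) else 0))
       \<and> (\<forall>n. [:0, 1:] * K n = P (n + 1) - smult (poly (P (n + 1)) 0 / poly (P n) 0) (P n))"
proof -
  let ?L = "L_matrix d l" and ?J = "hessenberg_matrix d \<beta> \<gamma>"
  define Q where "Q n = (\<Sum>k\<le>n. smult (?L n k) (K k))" for n
  \<comment> \<open>Row \<open>n\<close> of \<open>UL\<close> reaches column \<open>Suc n\<close>;
    padding by a zero term lets rows \<open>n\<close> and \<open>Suc n\<close> of \<open>L\<close>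
    be summed over one range.\<close>
  have Q_pad: "Q n = (\<Sum>k\<le>Suc n. smult (?L n k) (K k))" for n
    by (simp add: Q_def L_matrix_above)
  have K0: "K 0 = 1"
    and K: "[:0, 1:] * K n = Sum_any (\<lambda>k. smult (inf_matrix_mult (U_matrix m) ?L n k) (K k))" for n
    using assms(5) by (simp_all add: monic_sequence_generated_by_def)
  have P0: "P 0 = 1"
    using assms(2) by (simp add: monic_d_OPS_def)
  have xK: "[:0, 1:] * K n = smult (m (Suc n)) (Q n) + Q (Suc n)" for n
  proof -
    have "[:0, 1:] * K n = (\<Sum>k\<le>Suc n. smult (inf_matrix_mult (U_matrix m) ?L n k) (K k))"
      unfolding K by (rule Sum_any_atMost) (simp add: inf_matrix_mult_U_L L_matrix_above)
    also have "\<dots> = (\<Sum>k\<le>Suc n. smult (m (Suc n)) (smult (?L n k) (K k)))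
                    + (\<Sum>k\<le>Suc n. smult (?L (Suc n) k) (K k))"
      by (simp only: inf_matrix_mult_U_L smult_add_left sum.distrib smult_smult Suc_eq_plus1)
    finally show ?thesis
      using sum_distrib_left[of "[:m (Suc n):]" "\<lambda>k. smult (?L n k) (K k)" "{..Suc n}"]
      by (simp add: Q_pad[of n] Q_def[of "Suc n"] mult.commute del: sum.atMost_Suc)
  qed
  have xQ: "[:0, 1:] * Q n = (\<Sum>k\<le>Suc n. smult (?J n k) (Q k))" for n
  proof -
    have "[:0, 1:] * Q n = (\<Sum>k\<le>n. smult (?L n k) ([:0, 1:] * K k))"
      unfolding Q_def sum_distrib_left by (simp only: mult_smult_right)
    also have "\<dots> = (\<Sum>k\<le>n. smult (?L n k * m (Suc k)) (Q k))
                    + (\<Sum>k\<le>n. smult (?L n k) (Q (Suc k)))"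
      by (simp only: xK smult_add_right smult_smult sum.distrib)
    \<comment> \<open>The first sum gains a zero term above the diagonal, the second is shifted by
      one; together the coefficients are now the entries of \<open>LU\<close>.\<close>
    also have "\<dots> = (\<Sum>k\<le>Suc n. smult (?L n k * m (Suc k)) (Q k))
                    + (\<Sum>k\<le>Suc n. smult (if k = 0 then 0 else ?L n (k - 1)) (Q k))"
      unfolding sum.atMost_Suc_shift[of "\<lambda>k. smult (if k = 0 then 0 else ?L n (k - 1)) (Q k)"]
      by (simp add: L_matrix_above)
    also have "\<dots> = (\<Sum>k\<le>Suc n. smult (?J n k) (Q k))"
      by (simp only: assms(4) inf_matrix_mult_L_U smult_add_left sum.distrib Suc_eq_plus1)
    finally show ?thesis .
  qed
  have xP: "[:0, 1:] * P n = (\<Sum>k\<le>Suc n. smult (?J n k) (P k))" for n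
  proof -
    have "[:0, 1:] * P n = Sum_any (\<lambda>k. smult (?J n k) (P k))"
      using monic_d_OPS_generated_by_hessenberg[OF assms(2)]
      by (simp add: monic_sequence_generated_by_def)
    also have "\<dots> = (\<Sum>k\<le>Suc n. smult (?J n k) (P k))"
      by (rule Sum_any_atMost) (simp add: hessenberg_matrix_def)
    finally show ?thesis .
  qed
  have PQ: "P n = Q n" for n
    by (rule hessenberg_recurrence_unique[OF _ xP xQ])
       (simp_all add: hessenberg_matrix_def P0 Q_def K0 L_matrix_def)
  \<comment> \<open>At 0 the left side of \<open>xK\<close> vanishes, which leaves a linear equation
    for \<open>m (Suc n)\<close>.\<close>
  have m: "m (Suc n) = - (poly (P (n + 1)) 0 / poly (P n) 0)" for n
  proof -
    have "poly (P n) 0 \<noteq> 0"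
      using assms(3) P0 by (cases n) auto
    moreover have "m (Suc n) * poly (P n) 0 + poly (P (Suc n)) 0 = 0"
      using arg_cong[OF xK[of n], of "\<lambda>p. poly p 0"] by (simp add: PQ)
    ultimately show ?thesis
      by (simp add: field_simps add_eq_0_iff)
  qed
  show ?thesis
    \<comment> \<open>Replacing \<open>Q\<close> by \<open>P\<close> in \<open>xK\<close> gives the
      second identity; the first remains and is \<open>P = Q\<close> with \<open>Q\<close>
      unfolded.\<close>
    using xK by (simp add: PQ[symmetric] m) (simp add: PQ Q_def L_matrix_row_sum)
qed

end
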